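(* Let $\nu=\mu^{\mathrm{SW}}_{E,\boldsymbol p,\boldsymbol\eta}$ be the distribution of the subgraph-world model specified by a graph $G=(V,E)$ and vectors $\boldsymbol p\in[0,\tfrac12]^E$ and $\boldsymbol\eta\in(0,1]^V$, and let $\eta_{\min}=\min_{v\in V}\eta_v$. Then $\nu$ is $\frac{1}{2\eta_{\min}^2}$-coupling independent.
   Context: Graphs are finite, undirected and simple. For $v\in V$, $E_v$ denotes the set of edges incident to $v$. The subgraph-world model is the distribution over subsets $S\subseteq E$ with $$\mu^{\mathrm{SW}}_{E,\boldsymbol p,\boldsymbol\eta}(S)\ \propto\ \prod_{e\in S}p_e\prod_{f\in E\setminus S}(1-p_f)\prod_{v\in V:\ |S\cap E_v|\text{ odd}}\eta_v .$$ For a distribution $\mu$ over $2^U$ ($U$ finite) and $i\in U$, $\mu(\cdot\mid i)$ (resp. $\mu(\cdot\mid\overline i)$) denotes the law of $S\setminus\{i\}$ for $S\sim\mu$ conditioned on $i\in S$ (resp. $i\notin S$). The distribution $\mu$ is $C$-coupling independent if for every $i\in U$ (for which both conditional distributions are defined, i.e. $0<\Pr_{S\sim\mu}[i\in S]<1$) there is a coupling $(X,Y)$ of $\mu(\cdot\mid i)$ and $\mu(\cdot\mid\overline i)$ with $\mathbb E[|X\oplus Y|]\le C$, where $\oplus$ is symmetric difference. *)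

theory Defs
  imports "HOL-Probability.Probability"
begin

definition finite_simple_graph :: "'v set \<Rightarrow> 'v set set \<Rightarrow> bool" where
  "finite_simple_graph V E \<longleftrightarrow> finite V \<and> (\<forall>e\<in>E. e \<subseteq> V \<and> card e = 2)"

definition incident_edges :: "'v set set \<Rightarrow> 'v \<Rightarrow> 'v set set" where
  "incident_edges E v = {e \<in> E. v \<in> e}"

definition sw_weight ::
  "'v set \<Rightarrow> 'v set set \<Rightarrow> ('v set \<Rightarrow> real) \<Rightarrow> ('v \<Rightarrow> real) \<Rightarrow> 'v set set \<Rightarrow> real" where
  "sw_weight V E p \<eta> S =
     (\<Prod>e\<in>S. p e) * (\<Prod>f\<in>E - S. 1 - p f) *
     (\<Prod>v\<in>{v \<in> V. odd (card (S \<inter> incident_edges E v))}. \<eta> v)"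

definition subgraph_world ::
  "'v set \<Rightarrow> 'v set set \<Rightarrow> ('v set \<Rightarrow> real) \<Rightarrow> ('v \<Rightarrow> real) \<Rightarrow> 'v set set pmf" where
  "subgraph_world V E p \<eta> =
     embed_pmf (\<lambda>S. if S \<subseteq> E
       then sw_weight V E p \<eta> S / (\<Sum>T\<in>Pow E. sw_weight V E p \<eta> T) else 0)"

text \<open>
  The weights need not be normalisable for arbitrary parameters, and \<open>embed_pmf\<close> is only
  meaningful on mass functions; the following lemma shows that the definition is the intended one.
\<close>

lemma pmf_subgraph_world:
  assumes "finite_simple_graph V E"
    and p: "\<And>e. e \<in> E \<Longrightarrow> 0 \<le> p e \<and> p e < 1"
    and eta: "\<And>v. v \<in> V \<Longrightarrow> 0 < \<eta> v"
  shows "pmf (subgraph_world V E p \<eta>) S =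
    (if S \<subseteq> E then sw_weight V E p \<eta> S / (\<Sum>T\<in>Pow E. sw_weight V E p \<eta> T) else 0)"
proof -
  let ?w = "sw_weight V E p \<eta>"
  let ?Z = "\<Sum>T\<in>Pow E. ?w T"
  have "E \<subseteq> Pow V" and "finite V"
    using assms(1) by (auto simp: finite_simple_graph_def)
  then have fin: "finite (Pow E)"
    by (meson finite_Pow_iff finite_subset)
  have nonneg: "0 \<le> ?w T" if "T \<subseteq> E" for T
    using that p eta unfolding sw_weight_def
    by (intro mult_nonneg_nonneg prod_nonneg) (auto intro: less_imp_le)
  have "0 < ?w {}"
    using p by (auto simp: sw_weight_def intro!: prod_pos)
  moreover have "?w {} \<le> ?Z"
    using nonneg fin by (intro member_le_sum) auto
  ultimately have Z: "0 < ?Z" by linarith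
  let ?f = "\<lambda>S. if S \<subseteq> E then ?w S / ?Z else 0"
  have f: "0 \<le> ?f T" for T
    using nonneg Z by auto
  have "(\<integral>\<^sup>+T. ennreal (?f T) \<partial>count_space UNIV) = (\<Sum>T\<in>Pow E. ennreal (?f T))"
    by (rule nn_integral_count_space') (use fin in auto)
  also have "\<dots> = ennreal (\<Sum>T\<in>Pow E. ?f T)"
    by (rule sum_ennreal) (rule f)
  also have "(\<Sum>T\<in>Pow E. ?f T) = (\<Sum>T\<in>Pow E. ?w T / ?Z)"
    by (intro sum.cong) auto
  also have "\<dots> = 1"
    using Z by (simp flip: sum_divide_distrib)
  finally have one: "(\<integral>\<^sup>+T. ennreal (?f T) \<partial>count_space UNIV) = 1"
    by simp
  show ?thesis
    unfolding subgraph_world_def by (rule pmf_embed_pmf[OF f one])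
qed

definition cond_in :: "'a set pmf \<Rightarrow> 'a \<Rightarrow> 'a set pmf" where
  "cond_in \<mu> i = map_pmf (\<lambda>S. S - {i}) (cond_pmf \<mu> {S. i \<in> S})"

definition cond_notin :: "'a set pmf \<Rightarrow> 'a \<Rightarrow> 'a set pmf" where
  "cond_notin \<mu> i = map_pmf (\<lambda>S. S - {i}) (cond_pmf \<mu> {S. i \<notin> S})"

definition is_coupling :: "('a \<times> 'b) pmf \<Rightarrow> 'a pmf \<Rightarrow> 'b pmf \<Rightarrow> bool" where
  "is_coupling \<pi> \<mu> \<nu> \<longleftrightarrow> map_pmf fst \<pi> = \<mu> \<and> map_pmf snd \<pi> = \<nu>"

text \<open>
  The ground set \<open>U\<close> is finite and \<open>\<mu>\<close> lives on its subsets, so every coupling below has finite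
  support on pairs of finite sets; \<open>card\<close> and the expectation never take their default values.
\<close>

definition coupling_independent :: "'a set \<Rightarrow> 'a set pmf \<Rightarrow> real \<Rightarrow> bool" where
  "coupling_independent U \<mu> C \<longleftrightarrow>
     finite U \<and> set_pmf \<mu> \<subseteq> Pow U \<and>
     (\<forall>i\<in>U. 0 < measure_pmf.prob \<mu> {S. i \<in> S} \<and> measure_pmf.prob \<mu> {S. i \<in> S} < 1 \<longrightarrow>
        (\<exists>\<pi>. is_coupling \<pi> (cond_in \<mu> i) (cond_notin \<mu> i) \<and>
             measure_pmf.expectation \<pi> (\<lambda>(X, Y). real (card (sym_diff X Y))) \<le> C))"

end

theory Submission
  imports Defs
begin

text \<open>
  Conditioning on \<open>{a, b} \<in> S\<close> or \<open>{a, b} \<notin> S\<close> leaves two laws on the remaining edges that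
  differ only in which parities are penalised at \<open>a\<close> and \<open>b\<close>; by the triangle inequality it
  suffices to couple two laws whose penalised parity differs at one vertex \<open>u\<close>. First reveal the
  parity of \<open>u\<close>: optimally coupled, the two samples have equal parity at \<open>u\<close>, and can then be
  made equal, except with probability at most \<open>(1 - \<eta>\<^sub>u) / (1 + \<eta>\<^sub>u)\<close>. Otherwise reveal the
  edges at \<open>u\<close> until one of them, \<open>{u, v}\<close>, lies in exactly one sample; the discrepancy has then
  moved to \<open>v\<close>. This traces a trail that survives each newly visited vertex with probability at
  most \<open>q = (1 - h) / (1 + h)\<close>, where \<open>h = min \<eta>\<close>. As the graph is simple, a trail with \<open>N\<close>
  survivals uses at most quadratically many edges in \<open>N\<close>, and \<open>N\<close> is dominated by a geometric
  variable. With \<open>s = q / (1 - q) = (1 - h) / (2 * h)\<close> the expected length is at most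
  \<open>s * (1 + s) \<le> 1 / (4 * h\<^sup>2)\<close>.
\<close>

section \<open>Transport plans for unnormalised weights\<close>

text \<open>
  The marginals are \<open>f\<close> and \<open>g\<close> scaled by each other's total mass. A weight of total mass \<open>0\<close>,
  coming from conditioning on a null event, then needs no separate treatment.
\<close>

definition transport_plan ::
  "'a set \<Rightarrow> ('a set \<Rightarrow> real) \<Rightarrow> ('a set \<Rightarrow> real) \<Rightarrow> real \<Rightarrow> ('a set \<Rightarrow> 'a set \<Rightarrow> real) \<Rightarrow> bool" where
  "transport_plan F f g c \<pi> \<longleftrightarrow>
     (\<forall>X Y. X \<subseteq> F \<longrightarrow> Y \<subseteq> F \<longrightarrow> 0 \<le> \<pi> X Y) \<and>
     (\<forall>X. X \<subseteq> F \<longrightarrow> (\<Sum>Y\<in>Pow F. \<pi> X Y) = f X * sum g (Pow F)) \<and>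
     (\<forall>Y. Y \<subseteq> F \<longrightarrow> (\<Sum>X\<in>Pow F. \<pi> X Y) = g Y * sum f (Pow F)) \<and>
     (\<Sum>X\<in>Pow F. \<Sum>Y\<in>Pow F. \<pi> X Y * real (card (sym_diff X Y)))
       \<le> c * (sum f (Pow F) * sum g (Pow F))"

lemma transport_planD:
  assumes "transport_plan F f g c \<pi>"
  shows "X \<subseteq> F \<Longrightarrow> Y \<subseteq> F \<Longrightarrow> 0 \<le> \<pi> X Y"
    and "X \<subseteq> F \<Longrightarrow> (\<Sum>Y\<in>Pow F. \<pi> X Y) = f X * sum g (Pow F)"
    and "Y \<subseteq> F \<Longrightarrow> (\<Sum>X\<in>Pow F. \<pi> X Y) = g Y * sum f (Pow F)"
    and "(\<Sum>X\<in>Pow F. \<Sum>Y\<in>Pow F. \<pi> X Y * real (card (sym_diff X Y)))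
       \<le> c * (sum f (Pow F) * sum g (Pow F))"
  using assms unfolding transport_plan_def by blast+

definition transport :: "'a set \<Rightarrow> ('a set \<Rightarrow> real) \<Rightarrow> ('a set \<Rightarrow> real) \<Rightarrow> real \<Rightarrow> bool" where
  "transport F f g c \<longleftrightarrow> (\<exists>\<pi>. transport_plan F f g c \<pi>)"

lemma transportI:
  assumes "\<And>X Y. X \<subseteq> F \<Longrightarrow> Y \<subseteq> F \<Longrightarrow> 0 \<le> \<pi> X Y"
    and "\<And>X. X \<subseteq> F \<Longrightarrow> (\<Sum>Y\<in>Pow F. \<pi> X Y) = f X * sum g (Pow F)"
    and "\<And>Y. Y \<subseteq> F \<Longrightarrow> (\<Sum>X\<in>Pow F. \<pi> X Y) = g Y * sum f (Pow F)"
    and "(\<Sum>X\<in>Pow F. \<Sum>Y\<in>Pow F. \<pi> X Y * real (card (sym_diff X Y)))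
       \<le> c * (sum f (Pow F) * sum g (Pow F))"
  shows "transport F f g c"
  unfolding transport_def transport_plan_def using assms by (intro exI[of _ \<pi>]) blast

section \<open>Elementary operations on transport plans\<close>

lemma transport_cong:
  assumes "transport F f g c"
    and "\<And>X. X \<subseteq> F \<Longrightarrow> f X = f' X" and "\<And>X. X \<subseteq> F \<Longrightarrow> g X = g' X"
  shows "transport F f' g' c"
proof -
  have "sum f (Pow F) = sum f' (Pow F)" "sum g (Pow F) = sum g' (Pow F)"
    using assms by (auto intro!: sum.cong)
  then show ?thesis
    using assms unfolding transport_def transport_plan_def by simp
qed

lemma transport_mono:
  assumes "transport F f g c" "c \<le> c'"
    and "\<And>X. X \<subseteq> F \<Longrightarrow> 0 \<le> f X" and "\<And>X. X \<subseteq> F \<Longrightarrow> 0 \<le> g X"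
  shows "transport F f g c'"
proof -
  have "c * (sum f (Pow F) * sum g (Pow F)) \<le> c' * (sum f (Pow F) * sum g (Pow F))"
    using assms by (intro mult_right_mono mult_nonneg_nonneg sum_nonneg) auto
  moreover obtain \<pi> where "transport_plan F f g c \<pi>"
    using assms(1) by (auto simp: transport_def)
  note \<pi> = transport_planD[OF this]
  ultimately show ?thesis
    by (intro transportI[where \<pi> = \<pi>] \<pi>(1-3) order_trans[OF \<pi>(4)])
qed

text \<open>All prescribed marginals vanish when one total mass is \<open>0\<close>, so the zero
  plan works for every cost bound, even a negative one.\<close>

lemma transport_null:
  assumes "(\<forall>X\<subseteq>F. f X = 0) \<or> (\<forall>X\<subseteq>F. g X = 0)"
  shows "transport F f g c"
proof -
  have "sum f (Pow F) = 0 \<or> sum g (Pow F) = 0"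
    using assms by (auto intro!: sum.neutral)
  with assms show ?thesis
    by (intro transportI[where \<pi> = "\<lambda>_ _. 0"]) (auto intro!: sum.neutral)
qed

text \<open>Marginals and cost are bilinear in the two weights, so the plan is scaled by
  \<open>a * b\<close>. This absorbs the factors \<open>p e\<close> and \<open>1 - p e\<close> of a
  revealed edge.\<close>

lemma transport_scale:
  assumes "transport F f g c" "0 \<le> a" "0 \<le> b"
  shows "transport F (\<lambda>X. a * f X) (\<lambda>X. b * g X) c"
proof -
  from assms(1) obtain \<pi> where "transport_plan F f g c \<pi>"
    by (auto simp: transport_def)
  note \<pi> = transport_planD[OF this]
  have "a * b * (\<Sum>X\<in>Pow F. \<Sum>Y\<in>Pow F. \<pi> X Y * real (card (sym_diff X Y)))
     \<le> a * b * (c * (sum f (Pow F) * sum g (Pow F)))"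
    using \<pi>(4) assms by (intro mult_left_mono) auto
  then show ?thesis
    using assms \<pi>(1-3)
    by (intro transportI[where \<pi> = "\<lambda>X Y. a * b * \<pi> X Y"])
      (simp_all add: mult.assoc flip: sum_distrib_left, simp_all add: mult_ac)
qed

section \<open>Gluing and mixing of plans\<close>

lemma card_sym_diff_triangle:
  assumes "finite X" "finite Y" "finite Z"
  shows "card (sym_diff X Z) \<le> card (sym_diff X Y) + card (sym_diff Y Z)"
proof -
  have "card (sym_diff X Z) \<le> card (sym_diff X Y \<union> sym_diff Y Z)"
    using assms by (intro card_mono) auto
  also have "\<dots> \<le> card (sym_diff X Y) + card (sym_diff Y Z)"
    by (rule card_Un_le)
  finally show ?thesis .
qed

text \<open>Gluing: the two plans are joined conditionally independently given the middle sample,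
  which is then summed out. The costs add up by the triangle inequality for symmetric
  differences.\<close>

lemma transport_trans:
  assumes fin: "finite F" and fg: "transport F f g c" and gh: "transport F g h d"
    and g: "\<And>X. X \<subseteq> F \<Longrightarrow> 0 \<le> g X" and pos: "0 < sum g (Pow F)"
  shows "transport F f h (c + d)"
proof -
  define Zf Zg Zh where "Zf = sum f (Pow F)" and "Zg = sum g (Pow F)" and "Zh = sum h (Pow F)"
  note Z = Zf_def[symmetric] Zg_def[symmetric] Zh_def[symmetric]
  have Zg: "0 < Zg" using pos by (simp add: Zg_def)
  obtain \<pi> where "transport_plan F f g c \<pi>"
    using fg by (auto simp: transport_def)
  note \<pi> = transport_planD[OF this, unfolded Z]
  obtain \<rho> where "transport_plan F g h d \<rho>"
    using gh by (auto simp: transport_def)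
  note \<rho> = transport_planD[OF this, unfolded Z]
  \<comment> \<open>A middle sample of weight \<open>0\<close> carries no mass in either plan, so
    the division by \<open>g Y = 0\<close> in \<open>\<tau>\<close> below loses nothing.\<close>
  have \<pi>0: "\<pi> X Y = 0" if "X \<subseteq> F" "Y \<subseteq> F" "g Y = 0" for X Y
    using \<pi>(3)[of Y] sum_nonneg_eq_0_iff[of "Pow F" "\<lambda>X. \<pi> X Y"] \<pi>(1) that fin by auto
  have \<rho>0: "\<rho> Y X = 0" if "X \<subseteq> F" "Y \<subseteq> F" "g Y = 0" for X Y
    using \<rho>(2)[of Y] sum_nonneg_eq_0_iff[of "Pow F" "\<lambda>X. \<rho> Y X"] \<rho>(1) that fin by auto
  \<comment> \<open>The signs of \<open>Zf\<close> and \<open>Zh\<close> are read off the plans: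
    \<open>Zg * Zf\<close> is the total mass of \<open>\<pi>\<close>, \<open>Zg * Zh\<close> that of
    \<open>\<rho>\<close>.\<close>
  have "0 \<le> Zg * Zf"
    unfolding Zg_def sum_distrib_right using \<pi>(1,3) by (auto simp flip: \<pi>(3) intro!: sum_nonneg)
  then have Zf_ge: "0 \<le> Zf" using Zg by (simp add: zero_le_mult_iff)
  have "0 \<le> Zg * Zh"
    unfolding Zg_def sum_distrib_right using \<rho>(1,2) by (auto simp flip: \<rho>(2) intro!: sum_nonneg)
  then have Zh_ge: "0 \<le> Zh" using Zg by (simp add: zero_le_mult_iff)
  \<comment> \<open>Dividing by \<open>g Y\<close> conditions on the middle sample; the extra
    \<open>Zg\<close> brings the outer marginals to \<open>f X * Zh\<close> and
    \<open>h W * Zf\<close>.\<close>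
  define \<tau> where "\<tau> X Y W = \<pi> X Y * \<rho> Y W / (g Y * Zg)" for X Y W
  have \<tau>_ge: "0 \<le> \<tau> X Y W" if "X \<subseteq> F" "Y \<subseteq> F" "W \<subseteq> F" for X Y W
    using that \<pi>(1) \<rho>(1) g Zg by (auto simp: \<tau>_def)
  have \<tau>1: "(\<Sum>W\<in>Pow F. \<tau> X Y W) = \<pi> X Y * (Zh / Zg)" if "X \<subseteq> F" "Y \<subseteq> F" for X Y
  proof -
    have "(\<Sum>W\<in>Pow F. \<tau> X Y W) = \<pi> X Y * (g Y * Zh) / (g Y * Zg)"
      using \<rho>(2)[OF that(2)] by (simp add: \<tau>_def flip: sum_divide_distrib sum_distrib_left)
    then show ?thesis
      using \<pi>0[OF that] by (cases "g Y = 0") auto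
  qed
  have \<tau>2: "(\<Sum>X\<in>Pow F. \<tau> X Y W) = \<rho> Y W * (Zf / Zg)" if "Y \<subseteq> F" "W \<subseteq> F" for Y W
  proof -
    have "(\<Sum>X\<in>Pow F. \<tau> X Y W) = (g Y * Zf) * \<rho> Y W / (g Y * Zg)"
      using \<pi>(3)[OF that(1)] by (simp add: \<tau>_def flip: sum_divide_distrib sum_distrib_right)
    then show ?thesis
      using \<rho>0[of W Y] that by (cases "g Y = 0") auto
  qed
  let ?d = "\<lambda>X Y. real (card (sym_diff X Y))"
  show ?thesis
  proof (rule transportI[where \<pi> = "\<lambda>X W. \<Sum>Y\<in>Pow F. \<tau> X Y W"], unfold Z)
    fix X W assume "X \<subseteq> F" "W \<subseteq> F"
    then show "0 \<le> (\<Sum>Y\<in>Pow F. \<tau> X Y W)"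
      using \<tau>_ge by (intro sum_nonneg) auto
  next
    fix X assume X: "X \<subseteq> F"
    have "(\<Sum>W\<in>Pow F. \<Sum>Y\<in>Pow F. \<tau> X Y W) = (\<Sum>Y\<in>Pow F. \<Sum>W\<in>Pow F. \<tau> X Y W)"
      by (rule sum.swap)
    also have "\<dots> = (\<Sum>Y\<in>Pow F. \<pi> X Y) * (Zh / Zg)"
      unfolding sum_distrib_right using \<tau>1 X by (intro sum.cong) auto
    finally show "(\<Sum>W\<in>Pow F. \<Sum>Y\<in>Pow F. \<tau> X Y W) = f X * Zh"
      using \<pi>(2)[OF X] Zg by simp
  next
    fix W assume W: "W \<subseteq> F"
    have "(\<Sum>X\<in>Pow F. \<Sum>Y\<in>Pow F. \<tau> X Y W) = (\<Sum>Y\<in>Pow F. \<Sum>X\<in>Pow F. \<tau> X Y W)"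
      by (rule sum.swap)
    also have "\<dots> = (\<Sum>Y\<in>Pow F. \<rho> Y W) * (Zf / Zg)"
      unfolding sum_distrib_right using \<tau>2 W by (intro sum.cong) auto
    finally show "(\<Sum>X\<in>Pow F. \<Sum>Y\<in>Pow F. \<tau> X Y W) = h W * Zf"
      using \<rho>(3)[OF W] Zg by simp
  next
    have "(\<Sum>X\<in>Pow F. \<Sum>W\<in>Pow F. (\<Sum>Y\<in>Pow F. \<tau> X Y W) * ?d X W)
       \<le> (\<Sum>X\<in>Pow F. \<Sum>W\<in>Pow F. \<Sum>Y\<in>Pow F. \<tau> X Y W * (?d X Y + ?d Y W))"
      unfolding sum_distrib_right
    proof (intro sum_mono mult_left_mono)
      fix X Y W assume "X \<in> Pow F" "W \<in> Pow F" "Y \<in> Pow F"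
      moreover from this have "card (sym_diff X W) \<le> card (sym_diff X Y) + card (sym_diff Y W)"
        using fin by (intro card_sym_diff_triangle) (auto intro: finite_subset)
      ultimately show "?d X W \<le> ?d X Y + ?d Y W" "0 \<le> \<tau> X Y W"
        using \<tau>_ge by auto
    qed
    also have "\<dots> = (\<Sum>X\<in>Pow F. \<Sum>W\<in>Pow F. \<Sum>Y\<in>Pow F. \<tau> X Y W * ?d X Y)
        + (\<Sum>X\<in>Pow F. \<Sum>W\<in>Pow F. \<Sum>Y\<in>Pow F. \<tau> X Y W * ?d Y W)"
      by (simp add: distrib_left sum.distrib)
    also have "(\<Sum>X\<in>Pow F. \<Sum>W\<in>Pow F. \<Sum>Y\<in>Pow F. \<tau> X Y W * ?d X Y)
       = (\<Sum>X\<in>Pow F. \<Sum>Y\<in>Pow F. (\<Sum>W\<in>Pow F. \<tau> X Y W) * ?d X Y)"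
      unfolding sum_distrib_right by (intro sum.cong refl sum.swap)
    also have "\<dots> = (\<Sum>X\<in>Pow F. \<Sum>Y\<in>Pow F. \<pi> X Y * ?d X Y * (Zh / Zg))"
      by (intro sum.cong refl) (simp add: \<tau>1)
    also have "\<dots> = (\<Sum>X\<in>Pow F. \<Sum>Y\<in>Pow F. \<pi> X Y * ?d X Y) * (Zh / Zg)"
      by (simp only: sum_distrib_right)
    also have "(\<Sum>X\<in>Pow F. \<Sum>W\<in>Pow F. \<Sum>Y\<in>Pow F. \<tau> X Y W * ?d Y W)
       = (\<Sum>X\<in>Pow F. \<Sum>Y\<in>Pow F. \<Sum>W\<in>Pow F. \<tau> X Y W * ?d Y W)"
      by (intro sum.cong refl sum.swap)
    also have "\<dots> = (\<Sum>Y\<in>Pow F. \<Sum>X\<in>Pow F. \<Sum>W\<in>Pow F. \<tau> X Y W * ?d Y W)"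
      by (rule sum.swap)
    also have "\<dots> = (\<Sum>Y\<in>Pow F. \<Sum>W\<in>Pow F. (\<Sum>X\<in>Pow F. \<tau> X Y W) * ?d Y W)"
      unfolding sum_distrib_right by (intro sum.cong refl sum.swap)
    also have "\<dots> = (\<Sum>Y\<in>Pow F. \<Sum>W\<in>Pow F. \<rho> Y W * ?d Y W * (Zf / Zg))"
      by (intro sum.cong refl) (simp add: \<tau>2)
    also have "\<dots> = (\<Sum>Y\<in>Pow F. \<Sum>W\<in>Pow F. \<rho> Y W * ?d Y W) * (Zf / Zg)"
      by (simp only: sum_distrib_right)
    also have "(\<Sum>X\<in>Pow F. \<Sum>Y\<in>Pow F. \<pi> X Y * ?d X Y) * (Zh / Zg) +
        (\<Sum>Y\<in>Pow F. \<Sum>W\<in>Pow F. \<rho> Y W * ?d Y W) * (Zf / Zg)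
       \<le> c * (Zf * Zg) * (Zh / Zg) + d * (Zg * Zh) * (Zf / Zg)"
      using \<pi>(4) \<rho>(4) Zf_ge Zh_ge Zg by (intro add_mono mult_right_mono) auto
    also have "\<dots> = (c + d) * (Zf * Zh)"
      using Zg by (simp add: field_simps)
    finally show "(\<Sum>X\<in>Pow F. \<Sum>W\<in>Pow F. (\<Sum>Y\<in>Pow F. \<tau> X Y W) * ?d X W)
       \<le> (c + d) * (Zf * Zh)" .
  qed
qed

text \<open>
  The common part of the two mixtures stays in place; only the remaining mass is moved from
  \<open>f\<close> to \<open>g\<close>.
\<close>

lemma transport_mix_swap:
  assumes fin: "finite F" and fg: "transport F f g c" and c: "0 \<le> c"
    and f: "\<And>X. X \<subseteq> F \<Longrightarrow> 0 \<le> f X" and g: "\<And>X. X \<subseteq> F \<Longrightarrow> 0 \<le> g X"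
    and x: "0 \<le> x" "x \<le> 1"
  shows "transport F (\<lambda>X. f X + x * g X) (\<lambda>X. g X + x * f X) ((1 - x) / (1 + x) * c)"
proof -
  define a b where "a = sum f (Pow F)" and "b = sum g (Pow F)"
  note ab = a_def[symmetric] b_def[symmetric]
  have ab_ge: "0 \<le> a" "0 \<le> b"
    unfolding a_def b_def using f g by (auto intro!: sum_nonneg)
  have x2: "0 \<le> 1 - x\<^sup>2"
    using x by (simp add: power_le_one)
  obtain \<pi> where "transport_plan F f g c \<pi>"
    using fg by (auto simp: transport_def)
  note \<pi> = transport_planD[OF this, unfolded ab]
  \<comment> \<open>The mass kept on the diagonal. It is what \<open>(1 - x\<^sup>2) * \<pi>\<close>
    leaves over of the row marginal \<open>(f X + x * g X) * (b + x * a)\<close>, and equally of the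
    column marginal.\<close>
  define \<delta> where "\<delta> X = x\<^sup>2 * (b * f X + a * g X) + x * (a * f X + b * g X)" for X
  have \<delta>: "0 \<le> \<delta> X" if "X \<subseteq> F" for X
    using that f g x ab_ge by (auto simp: \<delta>_def)
  have sums: "(\<Sum>X\<in>Pow F. f X + x * g X) = a + x * b" "(\<Sum>X\<in>Pow F. g X + x * f X) = b + x * a"
    by (simp_all add: sum.distrib a_def b_def flip: sum_distrib_left)
  show ?thesis
  proof (rule transportI[where \<pi> = "\<lambda>X Y. (1 - x\<^sup>2) * \<pi> X Y + (if X = Y then \<delta> X else 0)"],
      unfold sums)
    fix X Y assume "X \<subseteq> F" "Y \<subseteq> F"
    then show "0 \<le> (1 - x\<^sup>2) * \<pi> X Y + (if X = Y then \<delta> X else 0)"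
      using \<pi>(1) \<delta> x2 by auto
  next
    fix X assume X: "X \<subseteq> F"
    then have "(\<Sum>Y\<in>Pow F. (1 - x\<^sup>2) * \<pi> X Y + (if X = Y then \<delta> X else 0))
      = (1 - x\<^sup>2) * (f X * b) + \<delta> X"
      using fin by (simp add: sum.distrib \<pi>(2) flip: sum_distrib_left)
    then show "(\<Sum>Y\<in>Pow F. (1 - x\<^sup>2) * \<pi> X Y + (if X = Y then \<delta> X else 0))
      = (f X + x * g X) * (b + x * a)"
      by (simp add: \<delta>_def algebra_simps power2_eq_square)
  next
    fix Y assume Y: "Y \<subseteq> F"
    then have "(\<Sum>X\<in>Pow F. (1 - x\<^sup>2) * \<pi> X Y + (if X = Y then \<delta> X else 0))
      = (1 - x\<^sup>2) * (g Y * a) + \<delta> Y"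
      using fin by (simp add: sum.distrib \<pi>(3) flip: sum_distrib_left)
    then show "(\<Sum>X\<in>Pow F. (1 - x\<^sup>2) * \<pi> X Y + (if X = Y then \<delta> X else 0))
      = (g Y + x * f Y) * (a + x * b)"
      by (simp add: \<delta>_def algebra_simps power2_eq_square)
  next
    have "(\<Sum>X\<in>Pow F. \<Sum>Y\<in>Pow F. ((1 - x\<^sup>2) * \<pi> X Y + (if X = Y then \<delta> X else 0)) *
        real (card (sym_diff X Y)))
      = (\<Sum>X\<in>Pow F. \<Sum>Y\<in>Pow F. (1 - x\<^sup>2) * (\<pi> X Y * real (card (sym_diff X Y))))"
      by (intro sum.cong refl) auto
    also have "\<dots> = (1 - x\<^sup>2) * (\<Sum>X\<in>Pow F. \<Sum>Y\<in>Pow F. \<pi> X Y * real (card (sym_diff X Y)))"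
      by (simp only: sum_distrib_left)
    also have "\<dots> \<le> (1 - x\<^sup>2) * (c * (a * b))"
      using \<pi>(4) x2 by (rule mult_left_mono)
    also have "\<dots> = ((1 - x) / (1 + x) * c) * ((1 + x)\<^sup>2 * (a * b))"
      using x by (simp add: divide_simps power2_eq_square) (simp add: algebra_simps)
    \<comment> \<open>The product of the new total masses exceeds
      \<open>(1 + x)\<^sup>2 * (a * b)\<close> by \<open>x * (a - b)\<^sup>2\<close>, so equal
      masses are the worst case.\<close>
    also have "\<dots> \<le> ((1 - x) / (1 + x) * c) * ((a + x * b) * (b + x * a))"
    proof (rule mult_left_mono)
      have "(a + x * b) * (b + x * a) - (1 + x)\<^sup>2 * (a * b) = x * (a - b)\<^sup>2"
        by (simp add: algebra_simps power2_eq_square)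
      also have "\<dots> \<ge> 0" using x by simp
      finally show "(1 + x)\<^sup>2 * (a * b) \<le> (a + x * b) * (b + x * a)" by simp
    qed (use x c in auto)
    finally show "(\<Sum>X\<in>Pow F. \<Sum>Y\<in>Pow F. ((1 - x\<^sup>2) * \<pi> X Y + (if X = Y then \<delta> X else 0)) *
        real (card (sym_diff X Y)))
      \<le> ((1 - x) / (1 + x) * c) * ((a + x * b) * (b + x * a))" .
  qed
qed

section \<open>Extending the ground set by one element\<close>

lemma sum_Pow_insert:
  assumes "finite F" "e \<notin> F"
  shows "sum h (Pow (insert e F)) = sum h (Pow F) + (\<Sum>X\<in>Pow F. h (insert e X))"
proof -
  have "inj_on (insert e) (Pow F)"
    using assms(2) by (auto simp: inj_on_def)
  moreover have "sum h (Pow (insert e F)) = sum h (Pow F) + sum h (insert e ` Pow F)"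
    unfolding Pow_insert using assms by (intro sum.union_disjoint) auto
  ultimately show ?thesis
    by (simp add: sum.reindex)
qed

text \<open>
  The membership of \<open>e\<close> is drawn independently in the two samples, so the four plans simply add up.
\<close>

lemma transport_insert:
  assumes fin: "finite F" and e: "e \<notin> F"
    and t00: "transport F f g c"
    and t01: "transport F f (\<lambda>X. g (insert e X)) (c - 1)"
    and t10: "transport F (\<lambda>X. f (insert e X)) g (c - 1)"
    and t11: "transport F (\<lambda>X. f (insert e X)) (\<lambda>X. g (insert e X)) c"
  shows "transport (insert e F) f g c"
proof -
  define f0 f1 g0 g1 where "f0 = sum f (Pow F)" and "f1 = (\<Sum>X\<in>Pow F. f (insert e X))"
    and "g0 = sum g (Pow F)" and "g1 = (\<Sum>X\<in>Pow F. g (insert e X))"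
  note Z = f0_def[symmetric] f1_def[symmetric] g0_def[symmetric] g1_def[symmetric]
  obtain A where "transport_plan F f g c A"
    using t00 by (auto simp: transport_def)
  note A = transport_planD[OF this, unfolded Z]
  obtain B where "transport_plan F f (\<lambda>X. g (insert e X)) (c - 1) B"
    using t01 by (auto simp: transport_def)
  note B = transport_planD[OF this, unfolded Z]
  obtain C where "transport_plan F (\<lambda>X. f (insert e X)) g (c - 1) C"
    using t10 by (auto simp: transport_def)
  note C = transport_planD[OF this, unfolded Z]
  obtain D where "transport_plan F (\<lambda>X. f (insert e X)) (\<lambda>X. g (insert e X)) c D"
    using t11 by (auto simp: transport_def)
  note D = transport_planD[OF this, unfolded Z]
  define \<pi> where "\<pi> X Y =
    (if e \<in> X then if e \<in> Y then D (X - {e}) (Y - {e}) else C (X - {e}) Y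
     else if e \<in> Y then B X (Y - {e}) else A X Y)" for X Y
  have \<pi>: "\<pi> X Y = A X Y" "\<pi> X (insert e Y) = B X Y"
    "\<pi> (insert e X) Y = C X Y" "\<pi> (insert e X) (insert e Y) = D X Y"
    if "X \<in> Pow F" "Y \<in> Pow F" for X Y
  proof -
    have "e \<notin> X" "e \<notin> Y" using that e by auto
    then show "\<pi> X Y = A X Y" "\<pi> X (insert e Y) = B X Y"
      "\<pi> (insert e X) Y = C X Y" "\<pi> (insert e X) (insert e Y) = D X Y"
      by (simp_all add: \<pi>_def)
  qed
  have d: "card (sym_diff X (insert e Y)) = card (sym_diff X Y) + 1"
    "card (sym_diff (insert e X) Y) = card (sym_diff X Y) + 1"
    "sym_diff (insert e X) (insert e Y) = sym_diff X Y"
    if "X \<in> Pow F" "Y \<in> Pow F" for X Y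
  proof -
    have n: "e \<notin> X" "e \<notin> Y" "finite X" "finite Y"
      using that e fin by (auto intro: finite_subset)
    then have "sym_diff X (insert e Y) = insert e (sym_diff X Y)"
      "sym_diff (insert e X) Y = insert e (sym_diff X Y)"
      by auto
    then show "card (sym_diff X (insert e Y)) = card (sym_diff X Y) + 1"
      "card (sym_diff (insert e X) Y) = card (sym_diff X Y) + 1"
      using n by simp_all
    show "sym_diff (insert e X) (insert e Y) = sym_diff X Y"
      using n by auto
  qed
  note split = sum_Pow_insert[OF fin e]
  have cases: thesis if "X \<subseteq> insert e F" "X \<subseteq> F \<Longrightarrow> thesis"
      "\<And>X'. X = insert e X' \<Longrightarrow> X' \<subseteq> F \<Longrightarrow> thesis" for X thesis
    using that(1) that(2) that(3)[of "X - {e}"] by blast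
  let ?d = "\<lambda>X Y. real (card (sym_diff X Y))"
  show ?thesis
  proof (rule transportI[where \<pi> = \<pi>], unfold split, unfold Z)
    fix X Y assume "X \<subseteq> insert e F" "Y \<subseteq> insert e F"
    then have "X - {e} \<subseteq> F" "Y - {e} \<subseteq> F" "e \<notin> X \<Longrightarrow> X \<subseteq> F" "e \<notin> Y \<Longrightarrow> Y \<subseteq> F"
      by auto
    then show "0 \<le> \<pi> X Y"
      using A(1) B(1) C(1) D(1) by (auto simp: \<pi>_def)
  next
    fix X assume "X \<subseteq> insert e F"
    then show "sum (\<pi> X) (Pow F) + (\<Sum>Y\<in>Pow F. \<pi> X (insert e Y)) = f X * (g0 + g1)"
      by (rule cases) (simp_all add: \<pi> A(2) B(2) C(2) D(2) distrib_left)
  next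
    fix Y assume "Y \<subseteq> insert e F"
    then show "(\<Sum>X\<in>Pow F. \<pi> X Y) + (\<Sum>X\<in>Pow F. \<pi> (insert e X) Y) = g Y * (f0 + f1)"
      by (rule cases) (simp_all add: \<pi> A(3) B(3) C(3) D(3) distrib_left)
  next
    have "(\<Sum>X\<in>Pow F. (\<Sum>Y\<in>Pow F. \<pi> X Y * ?d X Y)
         + (\<Sum>Y\<in>Pow F. \<pi> X (insert e Y) * ?d X (insert e Y)))
       + (\<Sum>X\<in>Pow F. (\<Sum>Y\<in>Pow F. \<pi> (insert e X) Y * ?d (insert e X) Y)
         + (\<Sum>Y\<in>Pow F. \<pi> (insert e X) (insert e Y) * ?d (insert e X) (insert e Y)))
       = (\<Sum>X\<in>Pow F. (\<Sum>Y\<in>Pow F. A X Y * ?d X Y) + (\<Sum>Y\<in>Pow F. B X Y * (?d X Y + 1)))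
       + (\<Sum>X\<in>Pow F. (\<Sum>Y\<in>Pow F. C X Y * (?d X Y + 1)) + (\<Sum>Y\<in>Pow F. D X Y * ?d X Y))"
      by (intro arg_cong2[of _ _ _ _ "(+)"] sum.cong refl) (simp_all only: \<pi> d of_nat_add of_nat_1)
    \<comment> \<open>In the blocks \<open>B\<close> and \<open>C\<close> the samples also differ in
      \<open>e\<close>, which costs one unit on total masses \<open>f0 * g1\<close> and
      \<open>f1 * g0\<close>; the budgets \<open>c - 1\<close> leave room for exactly that.\<close>
    also have "\<dots> = (\<Sum>X\<in>Pow F. \<Sum>Y\<in>Pow F. A X Y * ?d X Y)
       + ((\<Sum>X\<in>Pow F. \<Sum>Y\<in>Pow F. B X Y * ?d X Y) + f0 * g1)
       + ((\<Sum>X\<in>Pow F. \<Sum>Y\<in>Pow F. C X Y * ?d X Y) + f1 * g0)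
       + (\<Sum>X\<in>Pow F. \<Sum>Y\<in>Pow F. D X Y * ?d X Y)"
      using B(2) C(2)
      by (simp add: distrib_left sum.distrib f0_def f1_def flip: sum_distrib_right)
    also have "\<dots> \<le> c * (f0 * g0) + ((c - 1) * (f0 * g1) + f0 * g1)
       + ((c - 1) * (f1 * g0) + f1 * g0) + c * (f1 * g1)"
      using A(4) B(4) C(4) D(4) by linarith
    also have "\<dots> = c * ((f0 + f1) * (g0 + g1))"
      by (simp add: algebra_simps)
    finally show "(\<Sum>X\<in>Pow F. (\<Sum>Y\<in>Pow F. \<pi> X Y * ?d X Y)
         + (\<Sum>Y\<in>Pow F. \<pi> X (insert e Y) * ?d X (insert e Y)))
       + (\<Sum>X\<in>Pow F. (\<Sum>Y\<in>Pow F. \<pi> (insert e X) Y * ?d (insert e X) Y)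
         + (\<Sum>Y\<in>Pow F. \<pi> (insert e X) (insert e Y) * ?d (insert e X) (insert e Y)))
       \<le> c * ((f0 + f1) * (g0 + g1))" .
  qed
qed

section \<open>The trail of a single discrepancy\<close>

text \<open>
  \<open>B\<close> is the set of vertices at which even rather than odd degree is penalised. A vertex with
  \<open>\<eta> v = 0\<close> is one whose parity has been revealed: its degree is forced to be odd exactly on \<open>B\<close>.
\<close>

definition parity_weight ::
  "'v set \<Rightarrow> ('v set \<Rightarrow> real) \<Rightarrow> 'v set set \<Rightarrow> ('v \<Rightarrow> real) \<Rightarrow> 'v set \<Rightarrow> 'v set set \<Rightarrow> real" where
  "parity_weight V p F \<eta> B S =
     (\<Prod>e\<in>S. p e) * (\<Prod>f\<in>F - S. 1 - p f) *
     (\<Prod>v\<in>V. if odd (card {e \<in> S. v \<in> e}) \<longleftrightarrow> v \<in> B then 1 else \<eta> v)"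

section \<open>How one edge or one revealed parity changes the weight\<close>

lemma parity_weight_nonneg:
  assumes "\<And>e. e \<in> F \<Longrightarrow> 0 \<le> p e \<and> p e \<le> 1" and "\<And>v. v \<in> V \<Longrightarrow> 0 \<le> \<eta> v" and "S \<subseteq> F"
  shows "0 \<le> parity_weight V p F \<eta> B S"
  unfolding parity_weight_def using assms
  by (intro mult_nonneg_nonneg prod_nonneg) auto

lemma sw_weight_eq_parity_weight:
  assumes "finite V" "S \<subseteq> E"
  shows "sw_weight V E p \<eta> S = parity_weight V p E \<eta> {} S"
proof -
  have "S \<inter> incident_edges E v = {e \<in> S. v \<in> e}" for v
    using assms(2) by (auto simp: incident_edges_def)
  moreover have "(\<Prod>v\<in>{v \<in> V. odd (card {e \<in> S. v \<in> e})}. \<eta> v)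
      = (\<Prod>v\<in>V. if even (card {e \<in> S. v \<in> e}) then 1 else \<eta> v)"
    using assms(1) by (subst prod.inter_filter) (auto intro!: prod.cong)
  ultimately show ?thesis
    by (simp add: sw_weight_def parity_weight_def)
qed

lemma parity_weight_insert_edge_notin:
  assumes "finite F" "e \<notin> F" "S \<subseteq> F"
  shows "parity_weight V p (insert e F) \<eta> B S = (1 - p e) * parity_weight V p F \<eta> B S"
proof -
  have "insert e F - S = insert e (F - S)"
    using assms by auto
  then show ?thesis
    using assms by (simp add: parity_weight_def)
qed

text \<open>Adding \<open>e\<close> flips the degree parity exactly at the vertices in
  \<open>e\<close>. Toggling the penalised parity at these vertices compensates for it.\<close>

lemma parity_weight_insert_edge_in:
  assumes "finite F" "e \<notin> F" "S \<subseteq> F"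
  shows "parity_weight V p (insert e F) \<eta> B (insert e S)
    = p e * parity_weight V p F \<eta> (sym_diff B e) S"
proof -
  have S: "finite S" "e \<notin> S" "insert e F - insert e S = F - S"
    using assms by (auto intro: finite_subset)
  have "{f \<in> insert e S. v \<in> f} = (if v \<in> e then insert e {f \<in> S. v \<in> f} else {f \<in> S. v \<in> f})" for v
    by auto
  then have "odd (card {f \<in> insert e S. v \<in> f}) \<longleftrightarrow> odd (card {f \<in> S. v \<in> f}) \<noteq> (v \<in> e)" for v
    using S by auto
  then have "(odd (card {f \<in> insert e S. v \<in> f}) \<longleftrightarrow> v \<in> B)
      \<longleftrightarrow> (odd (card {f \<in> S. v \<in> f}) \<longleftrightarrow> v \<in> sym_diff B e)" for v
    by auto
  then show ?thesis
    using S by (simp add: parity_weight_def)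
qed

text \<open>For each \<open>S\<close> at most one summand is nonzero: the first if the parity at
  \<open>u\<close> is unpenalised, the second, with the penalty \<open>\<eta> u\<close> pulled out,
  if it is penalised.\<close>

lemma parity_weight_reveal_parity:
  assumes "finite V" "u \<in> V"
  shows "parity_weight V p F \<eta> B S = parity_weight V p F (\<eta>(u := 0)) B S
    + \<eta> u * parity_weight V p F (\<eta>(u := 0)) (sym_diff B {u}) S"
proof -
  define P where "P = (\<Prod>v\<in>V - {u}. if odd (card {e \<in> S. v \<in> e}) \<longleftrightarrow> v \<in> B then 1 else \<eta> v)"
  \<comment> \<open>Changes at \<open>u\<close> alone affect one factor of the product;
    \<open>B'\<close> and \<open>\<eta>'\<close> are generic so that all three weights are
    covered.\<close>
  have "(\<Prod>v\<in>V. if odd (card {e \<in> S. v \<in> e}) \<longleftrightarrow> v \<in> B' then 1 else \<eta>' v)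
      = (if odd (card {e \<in> S. u \<in> e}) \<longleftrightarrow> u \<in> B' then 1 else \<eta>' u) * P"
    if "B' - {u} = B - {u}" "\<And>v. v \<noteq> u \<Longrightarrow> \<eta>' v = \<eta> v" for B' \<eta>'
  proof -
    have "v \<in> B' \<longleftrightarrow> v \<in> B" if "v \<noteq> u" for v
      using that \<open>B' - {u} = B - {u}\<close> by blast
    then show ?thesis
      unfolding prod.remove[OF assms] P_def using that(2)
      by (intro arg_cong2[of _ _ _ _ "(*)"] refl prod.cong) auto
  qed
  note P = this[of B \<eta>] this[of B "\<eta>(u := 0)"] this[of "sym_diff B {u}" "\<eta>(u := 0)"]
  have "sym_diff B {u} - {u} = B - {u}"
    by auto
  with P show ?thesis
    unfolding parity_weight_def by (auto simp: algebra_simps)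
qed

lemma parity_weight_eq_0:
  assumes "finite V" "u \<in> V" "\<eta> u = 0" "\<not> (odd (card {e \<in> S. u \<in> e}) \<longleftrightarrow> u \<in> B)"
  shows "parity_weight V p F \<eta> B S = 0"
  unfolding parity_weight_def using assms by (auto intro!: prod_zero)

section \<open>Counting edges inside a vertex set\<close>

lemma finite_simple_graph_subset:
  "finite_simple_graph V E \<Longrightarrow> F \<subseteq> E \<Longrightarrow> finite_simple_graph V F"
  by (auto simp: finite_simple_graph_def)

lemma finite_simple_graph_finite_edges:
  "finite_simple_graph V E \<Longrightarrow> finite E"
  unfolding finite_simple_graph_def by (meson PowI finite_Pow_iff finite_subset subsetI)

text \<open>Simplicity enters here: an edge that becomes inner when \<open>u\<close> joins
  \<open>D\<close> has the form \<open>{u, v}\<close> with \<open>v \<in> D\<close>, and each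
  \<open>v\<close> gives only one such edge.\<close>

lemma card_edges_within_insert:
  assumes "finite_simple_graph V F" "D \<subseteq> V"
  shows "card {e \<in> F. e \<subseteq> insert u D} \<le> card {e \<in> F. e \<subseteq> D} + card D"
proof -
  have fin: "finite D" "finite F"
    using assms finite_simple_graph_finite_edges by (auto simp: finite_simple_graph_def intro: finite_subset)
  have "{e \<in> F. e \<subseteq> insert u D} \<subseteq> {e \<in> F. e \<subseteq> D} \<union> (\<lambda>v. {u, v}) ` D"
  proof
    fix e assume e: "e \<in> {e \<in> F. e \<subseteq> insert u D}"
    then have "card e = 2"
      using assms(1) by (auto simp: finite_simple_graph_def)
    then obtain x y where "e = {x, y}" "x \<noteq> y"
      by (auto simp: card_2_iff)
    with e show "e \<in> {e \<in> F. e \<subseteq> D} \<union> (\<lambda>v. {u, v}) ` D"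
      by auto
  qed
  then have "card {e \<in> F. e \<subseteq> insert u D} \<le> card ({e \<in> F. e \<subseteq> D} \<union> (\<lambda>v. {u, v}) ` D)"
    using fin by (intro card_mono) auto
  also have "\<dots> \<le> card {e \<in> F. e \<subseteq> D} + card ((\<lambda>v. {u, v}) ` D)"
    by (rule card_Un_le)
  also have "\<dots> \<le> card {e \<in> F. e \<subseteq> D} + card D"
    using card_image_le[OF fin(1)] by simp
  finally show ?thesis .
qed

text \<open>
  Potential function of the trail. Let \<open>D\<close> be the set of vertices with revealed parity. The first
  term pays for all unused edges inside \<open>D\<close>, the second for the step that leaves \<open>D\<close>. When \<open>u\<close>
  joins \<open>D\<close>, at most \<open>card D\<close> edges become inner ones, so the last term \<open>\<psi> k\<close>, with
  \<open>k = card D\<close>, has to satisfy \<open>\<psi> k \<ge> q * (k + 1 + \<psi> (k + 1))\<close>; \<open>\<psi> k = s * (k + 1 + s)\<close> is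
  the linear solution.
\<close>

lemma transport_single_discrepancy:
  fixes h s :: real
  assumes "finite_simple_graph V F" and "\<forall>e\<in>F. 0 \<le> p e \<and> p e \<le> 1"
    and "\<forall>v\<in>V. \<eta> v = 0 \<or> h \<le> \<eta> v \<and> \<eta> v \<le> 1" and "u \<in> V"
    and h: "0 < h" "h \<le> 1" and s_def: "s = (1 - h) / (2 * h)"
  shows "transport F (parity_weight V p F \<eta> B) (parity_weight V p F \<eta> (sym_diff B {u}))
    (card {e \<in> F. e \<subseteq> {v \<in> V. \<eta> v = 0}} + (if \<eta> u = 0 then 1 else 0)
      + s * (card {v \<in> V. \<eta> v = 0} + 1 + s))"
  using assms(1-4)
\<comment> \<open>Revealing a parity lowers the second summand of the measure, revealing an edge the
  first. The set \<open>B\<close> and the vertex \<open>u\<close> vary because the discrepancy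
  moves.\<close>
proof (induction "card F + card {v \<in> V. \<eta> v \<noteq> 0}" arbitrary: F \<eta> B u rule: less_induct)
  case less
  have finV: "finite V"
    using less.prems(1) by (simp add: finite_simple_graph_def)
  have finF: "finite F"
    using less.prems(1) by (rule finite_simple_graph_finite_edges)
  have s: "0 \<le> s"
    using h by (simp add: s_def)
  define D where "D = {v \<in> V. \<eta> v = 0}"
  have finD: "finite D" "D \<subseteq> V"
    using finV by (auto simp: D_def)
  have nonneg: "0 \<le> parity_weight V p F' \<eta> B' S" if "S \<subseteq> F'" "F' \<subseteq> F" for B' S F'
    using less.prems that h by (intro parity_weight_nonneg) force+
  show ?case
  proof (cases "\<eta> u = 0")
    case False
    let ?\<eta> = "\<eta>(u := 0)"
    have \<eta>u: "h \<le> \<eta> u" "\<eta> u \<le> 1"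
      using less.prems False by auto
    have D': "{v \<in> V. ?\<eta> v = 0} = insert u D"
      using less.prems(4) by (auto simp: D_def)
    have "{v \<in> V. ?\<eta> v \<noteq> 0} \<subset> {v \<in> V. \<eta> v \<noteq> 0}"
      using False less.prems(4) by auto
    then have "card {v \<in> V. ?\<eta> v \<noteq> 0} < card {v \<in> V. \<eta> v \<noteq> 0}"
      using finV by (intro psubset_card_mono) auto
    moreover have "\<forall>v\<in>V. ?\<eta> v = 0 \<or> h \<le> ?\<eta> v \<and> ?\<eta> v \<le> 1"
      using less.prems(3) by auto
    moreover have "card (insert u D) = card D + 1"
      using False finD by (simp add: D_def)
    ultimately have t: "transport F (parity_weight V p F ?\<eta> B) (parity_weight V p F ?\<eta> (sym_diff B {u}))
        (card {e \<in> F. e \<subseteq> insert u D} + 1 + s * (card D + 1 + 1 + s))"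
      using less.hyps[of F ?\<eta> u B] less.prems by (simp add: D' del: fun_upd_apply) (simp add: add_ac)
    define c where "c = card {e \<in> F. e \<subseteq> insert u D} + 1 + s * (card D + 1 + 1 + s)"
    have c: "0 \<le> c"
      using s by (simp add: c_def)
    have nonneg': "0 \<le> parity_weight V p F ?\<eta> B' S" if "S \<subseteq> F" for B' S
      using less.prems that h by (intro parity_weight_nonneg) force+
    \<comment> \<open>Both laws mix the same two revealed laws, with the roles swapped, so a
      discrepancy survives with probability at most
      \<open>(1 - \<eta> u) / (1 + \<eta> u)\<close>.\<close>
    have "transport F
        (\<lambda>X. parity_weight V p F ?\<eta> B X + \<eta> u * parity_weight V p F ?\<eta> (sym_diff B {u}) X)
        (\<lambda>X. parity_weight V p F ?\<eta> (sym_diff B {u}) X + \<eta> u * parity_weight V p F ?\<eta> B X)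
        ((1 - \<eta> u) / (1 + \<eta> u) * c)"
      using \<eta>u h by (intro transport_mix_swap finF t[folded c_def] c nonneg') auto
    then have "transport F (parity_weight V p F \<eta> B) (parity_weight V p F \<eta> (sym_diff B {u}))
        ((1 - \<eta> u) / (1 + \<eta> u) * c)"
    proof (rule transport_cong)
      have "sym_diff (sym_diff B {u}) {u} = B"
        by auto
      then show "parity_weight V p F ?\<eta> (sym_diff B {u}) X + \<eta> u * parity_weight V p F ?\<eta> B X
          = parity_weight V p F \<eta> (sym_diff B {u}) X" for X
        using parity_weight_reveal_parity[OF finV less.prems(4), of p F \<eta> "sym_diff B {u}" X]
        by simp
    qed (rule parity_weight_reveal_parity[OF finV less.prems(4), symmetric])
    then show ?thesis
    proof (rule transport_mono)
      define k m where "k = real (card D)" and "m = real (card {e \<in> F. e \<subseteq> D})"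
      define q where "q = (1 - h) / (1 + h)"
      have "real (card {e \<in> F. e \<subseteq> insert u D}) \<le> m + k"
        using card_edges_within_insert[OF less.prems(1) finD(2), of u] by (simp add: m_def k_def)
      \<comment> \<open>In this factored form \<open>q * (1 + s) = s\<close> turns the second
        summand, times \<open>q\<close>, into the last term of the potential for \<open>k\<close>;
        for \<open>m\<close> the bound \<open>q \<le> 1\<close> is enough.\<close>
      then have "c \<le> m + (1 + s) * (k + 1 + s)"
        by (simp add: c_def k_def algebra_simps)
      moreover have "(1 - \<eta> u) / (1 + \<eta> u) \<le> q"
        using \<eta>u h by (simp add: q_def frac_le)
      moreover have "1 + s = (1 + h) / (2 * h)"
        using h by (simp add: s_def field_simps)
      then have q: "0 \<le> q" "q \<le> 1" "q * (1 + s) = s"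
        using h by (simp_all add: q_def s_def)
      ultimately have "(1 - \<eta> u) / (1 + \<eta> u) * c \<le> q * (m + (1 + s) * (k + 1 + s))"
        using c by (intro mult_mono)
      also have "\<dots> = q * m + s * (k + 1 + s)"
        using q(3) by (simp add: distrib_left flip: mult.assoc)
      also have "\<dots> \<le> m + s * (k + 1 + s)"
        using q by (simp add: m_def mult_left_le_one_le)
      finally show "(1 - \<eta> u) / (1 + \<eta> u) * c
          \<le> card {e \<in> F. e \<subseteq> {v \<in> V. \<eta> v = 0}} + (if \<eta> u = 0 then 1 else 0)
            + s * (card {v \<in> V. \<eta> v = 0} + 1 + s)"
        using False by (simp add: m_def k_def D_def add_ac)
    qed (use nonneg in auto)
  next
    case True
    show ?thesis
    proof (cases "\<exists>e\<in>F. u \<in> e")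
      case False
      \<comment> \<open>With no edge left at \<open>u\<close> its degree is \<open>0\<close>, so the
        law that forces odd degree is null. One of \<open>B\<close> and
        \<open>sym_diff B {u}\<close> contains \<open>u\<close>.\<close>
      have "parity_weight V p F \<eta> B' X = 0" if "X \<subseteq> F" "u \<in> B'" for X B'
      proof -
        have "{e \<in> X. u \<in> e} = {}"
          using False that by auto
        then have "card {e \<in> X. u \<in> e} = 0"
          by (simp only: card.empty)
        then show ?thesis
          using that by (intro parity_weight_eq_0[where \<eta> = \<eta>, OF finV less.prems(4) True]) simp
      qed
      then show ?thesis
        by (intro transport_null) (cases "u \<in> B"; auto)
    next
      case True':  True
      then obtain e where e: "e \<in> F" "u \<in> e"
        by auto
      then have "card e = 2" "e \<subseteq> V"
        using less.prems(1) by (auto simp: finite_simple_graph_def)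
      with e(2) obtain v where v: "e = {u, v}" "u \<noteq> v" "v \<in> V"
        by (auto simp: card_2_iff)
      define F' where "F' = F - {e}"
      have F': "F = insert e F'" "e \<notin> F'" "finite F'" "F' \<subseteq> F"
        using e finF by (auto simp: F'_def)
      define w where "w = parity_weight V p F' \<eta>"
      define c where "c = card {e \<in> F. e \<subseteq> D} + 1 + s * (card D + 1 + s)"
      have IH: "transport F' (w B') (w (sym_diff B' {x}))
         (card {e \<in> F'. e \<subseteq> D} + (if \<eta> x = 0 then 1 else 0) + s * (card D + 1 + s))"
        if "x \<in> V" for x B'
        unfolding w_def D_def
      proof (rule less.hyps)
        show "card F' + card {v \<in> V. \<eta> v \<noteq> 0} < card F + card {v \<in> V. \<eta> v \<noteq> 0}"
          using F' by simp
        show "finite_simple_graph V F'"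
          using less.prems(1) F'(4) by (rule finite_simple_graph_subset)
      qed (use less.prems F'(4) that in auto)
      have w: "0 \<le> w B' X" if "X \<subseteq> F'" for B' X
        unfolding w_def using nonneg that F' by auto
      \<comment> \<open>If \<open>e\<close> has the same status in both samples, the discrepancy
        stays at \<open>u\<close>.\<close>
      have IHu: "transport F' (w B') (w (sym_diff B' {u})) c" for B'
      proof (rule transport_mono[OF IH[OF less.prems(4)]])
        have "card {e \<in> F'. e \<subseteq> D} \<le> card {e \<in> F. e \<subseteq> D}"
          using finF F' by (intro card_mono) auto
        then show "card {e \<in> F'. e \<subseteq> D} + (if \<eta> u = 0 then 1 else 0) + s * (card D + 1 + s) \<le> c"
          by (simp add: c_def)
      qed (use w in auto)
      \<comment> \<open>If \<open>e\<close> lies in exactly one sample, the discrepancy moves to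
        \<open>v\<close> and one unit must be saved. If \<open>v\<close> is revealed,
        \<open>e\<close> was an inner edge of \<open>D\<close> and is used up; otherwise the summand
        \<open>1\<close> for a revealed end disappears.\<close>
      have IHv: "transport F' (w B') (w (sym_diff B' {v})) (c - 1)" for B'
      proof (rule transport_mono[OF IH[OF v(3)]])
        have "card {e \<in> F'. e \<subseteq> D} + (if \<eta> v = 0 then 1 else 0) \<le> card {e \<in> F. e \<subseteq> D}"
        proof (cases "\<eta> v = 0")
          assume "\<eta> v = 0"
          then have "e \<subseteq> D"
            using v less.prems(4) True by (auto simp: D_def)
          then have "{e \<in> F. e \<subseteq> D} = insert e {e \<in> F'. e \<subseteq> D}"
            using F' by auto
          then show ?thesis
            using F' by simp
        next
          assume "\<eta> v \<noteq> 0"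
          then show ?thesis
            using finF F' by (auto intro: card_mono)
        qed
        then show "card {e \<in> F'. e \<subseteq> D} + (if \<eta> v = 0 then 1 else 0) + s * (card D + 1 + s) \<le> c - 1"
          by (simp add: c_def split: if_splits)
      qed (use w in auto)
      have out: "parity_weight V p F \<eta> B' X = (1 - p e) * w B' X" if "X \<subseteq> F'" for B' X
        using parity_weight_insert_edge_notin[OF F'(3,2) that] by (simp add: w_def F'(1))
      have inn: "parity_weight V p F \<eta> B' (insert e X) = p e * w (sym_diff B' e) X" if "X \<subseteq> F'" for B' X
        using parity_weight_insert_edge_in[OF F'(3,2) that] by (simp add: w_def F'(1))
      have pe: "0 \<le> p e" "0 \<le> 1 - p e"
        using less.prems(2) e by auto
      let ?f = "parity_weight V p F \<eta> B" and ?g = "parity_weight V p F \<eta> (sym_diff B {u})"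
      \<comment> \<open>Since \<open>e = {u, v}\<close>, toggling \<open>e\<close> and one endpoint
        amounts to toggling the other endpoint.\<close>
      have flips: "sym_diff (sym_diff B {u}) e = sym_diff B {v}"
        "sym_diff (sym_diff B e) {u} = sym_diff B {v}"
        "sym_diff (sym_diff B e) {v} = sym_diff B {u}"
        using v by auto
      have "transport (insert e F') ?f ?g c"
      proof (rule transport_insert[OF F'(3,2)])
        show "transport F' ?f ?g c"
          by (rule transport_cong[OF transport_scale[OF IHu pe(2) pe(2)]]) (simp_all only: out)
        show "transport F' ?f (\<lambda>X. ?g (insert e X)) (c - 1)"
          by (rule transport_cong[OF transport_scale[OF IHv pe(2) pe(1)]])
            (simp_all only: out inn flips)
        show "transport F' (\<lambda>X. ?f (insert e X)) ?g (c - 1)"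
          by (rule transport_cong[OF transport_scale[OF IHv[of "sym_diff B e"] pe(1) pe(2)]])
            (simp_all only: out inn flips)
        show "transport F' (\<lambda>X. ?f (insert e X)) (\<lambda>X. ?g (insert e X)) c"
          by (rule transport_cong[OF transport_scale[OF IHu[of "sym_diff B e"] pe(1) pe(1)]])
            (simp_all only: inn flips)
      qed
      then show ?thesis
        using True by (simp add: c_def D_def flip: F'(1))
    qed
  qed
qed

section \<open>Coupling independence\<close>

text \<open>The normalising constants satisfy \<open>K * Zf = 1\<close> and
  \<open>L * Zg = 1\<close>, so \<open>K * L * \<pi>\<close> is a probability mass function with the
  right marginals and expected cost at most \<open>c\<close>.\<close>

lemma coupling_of_transport:
  assumes fin: "finite F" and t: "transport F f g c"
    and M: "\<And>X. pmf M X = (if X \<subseteq> F then K * f X else 0)" "0 \<le> K"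
    and N: "\<And>X. pmf N X = (if X \<subseteq> F then L * g X else 0)" "0 \<le> L"
  shows "\<exists>\<pi>. is_coupling \<pi> M N \<and>
    measure_pmf.expectation \<pi> (\<lambda>(X, Y). real (card (sym_diff X Y))) \<le> c"
proof -
  define Zf Zg where "Zf = sum f (Pow F)" and "Zg = sum g (Pow F)"
  note Z = Zf_def[symmetric] Zg_def[symmetric]
  have "set_pmf M \<subseteq> Pow F" "set_pmf N \<subseteq> Pow F"
    by (auto simp: set_pmf_iff M(1) N(1) split: if_splits)
  then have "sum (pmf M) (Pow F) = 1" "sum (pmf N) (Pow F) = 1"
    using fin by (simp_all add: sum_pmf_eq_1)
  then have one: "K * Zf = 1" "L * Zg = 1"
    by (simp_all add: M(1) N(1) Zf_def Zg_def sum_distrib_left)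
  obtain \<pi> where "transport_plan F f g c \<pi>"
    using t by (auto simp: transport_def)
  note \<pi> = transport_planD[OF this, unfolded Z]
  define \<tau> where "\<tau> = (\<lambda>(X, Y). if X \<subseteq> F \<and> Y \<subseteq> F then K * L * \<pi> X Y else 0)"
  have \<tau>_ge: "0 \<le> \<tau> z" for z
    using \<pi>(1) M(2) N(2) by (auto simp: \<tau>_def split: prod.splits)
  have row: "(\<Sum>Y\<in>Pow F. \<tau> (X, Y)) = pmf M X" for X
    using one by (cases "X \<subseteq> F") (auto simp: \<tau>_def M(1) \<pi>(2) simp flip: sum_distrib_left)
  have col: "(\<Sum>X\<in>Pow F. \<tau> (X, Y)) = pmf N Y" for Y
    using one by (cases "Y \<subseteq> F") (auto simp: \<tau>_def N(1) \<pi>(3) simp flip: sum_distrib_left)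
  let ?A = "Pow F \<times> Pow F"
  have sum1: "sum \<tau> ?A = 1"
    using \<open>sum (pmf M) (Pow F) = 1\<close> by (simp add: row sum.cartesian_product')
  have "(\<integral>\<^sup>+z. ennreal (\<tau> z) \<partial>count_space UNIV) = (\<Sum>z\<in>?A. ennreal (\<tau> z))"
    by (rule nn_integral_count_space') (use fin in \<open>auto simp: \<tau>_def split: if_splits\<close>)
  also have "\<dots> = 1"
    using sum1 \<tau>_ge by (simp add: sum_ennreal)
  finally have pmf: "pmf (embed_pmf \<tau>) z = \<tau> z" for z
    using \<tau>_ge by (intro pmf_embed_pmf)
  let ?P = "embed_pmf \<tau>"
  have supp: "set_pmf ?P \<subseteq> ?A"
  proof
    fix z assume "z \<in> set_pmf ?P"
    then have "\<tau> z \<noteq> 0"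
      by (simp add: set_pmf_iff pmf)
    then show "z \<in> ?A"
      by (cases z) (auto simp: \<tau>_def split: if_splits)
  qed
  \<comment> \<open>Fibres of the projections may be infinite; only their finite part inside
    \<open>Pow F \<times> Pow F\<close> carries mass.\<close>
  have prob: "measure_pmf.prob ?P B = sum \<tau> C" if "B \<inter> ?A \<subseteq> C" "C \<subseteq> B" "finite C" for B C
  proof -
    have "measure_pmf.prob ?P B = measure_pmf.prob ?P C"
      using that supp by (intro measure_pmf.finite_measure_eq_AE) (auto simp: AE_measure_pmf_iff)
    then show ?thesis
      using that(3) by (simp add: measure_measure_pmf_finite pmf)
  qed
  have "is_coupling ?P M N"
    unfolding is_coupling_def
  proof (intro conjI pmf_eqI)
    fix X
    have "pmf (map_pmf fst ?P) X = sum \<tau> (Pair X ` Pow F)"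
      unfolding pmf_map by (rule prob) (use fin in auto)
    then show "pmf (map_pmf fst ?P) X = pmf M X"
      by (simp add: sum.reindex row inj_on_def)
  next
    fix Y
    have "pmf (map_pmf snd ?P) Y = sum \<tau> ((\<lambda>X. (X, Y)) ` Pow F)"
      unfolding pmf_map by (rule prob) (use fin in auto)
    then show "pmf (map_pmf snd ?P) Y = pmf N Y"
      by (simp add: sum.reindex col inj_on_def)
  qed
  moreover have "measure_pmf.expectation ?P (\<lambda>(X, Y). real (card (sym_diff X Y))) \<le> c"
  proof -
    have "measure_pmf.expectation ?P (\<lambda>(X, Y). real (card (sym_diff X Y)))
        = (\<Sum>z\<in>?A. (case z of (X, Y) \<Rightarrow> real (card (sym_diff X Y))) * pmf ?P z)"
      using fin supp by (intro integral_measure_pmf_real) auto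
    also have "\<dots> = (\<Sum>X\<in>Pow F. \<Sum>Y\<in>Pow F. (K * L) * (\<pi> X Y * real (card (sym_diff X Y))))"
      unfolding sum.cartesian_product by (intro sum.cong) (auto simp: pmf, simp add: \<tau>_def)
    also have "\<dots> = K * L * (\<Sum>X\<in>Pow F. \<Sum>Y\<in>Pow F. \<pi> X Y * real (card (sym_diff X Y)))"
      by (simp only: sum_distrib_left)
    also have "\<dots> \<le> K * L * (c * (Zf * Zg))"
      using \<pi>(4) M(2) N(2) by (intro mult_left_mono) auto
    also have "\<dots> = c * (K * Zf) * (L * Zg)"
      by (simp add: mult_ac)
    finally show ?thesis
      using one by simp
  qed
  ultimately show ?thesis
    by blast
qed

section \<open>Mass functions of the conditional laws\<close>

text \<open>Deleting \<open>i\<close> is injective on the sets that contain \<open>i\<close>: only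
  \<open>insert i T\<close> is sent to \<open>T\<close>, and nothing is if
  \<open>i \<in> T\<close>.\<close>

lemma pmf_cond_in:
  assumes "0 < measure_pmf.prob \<mu> {S. i \<in> S}"
  shows "pmf (cond_in \<mu> i) T =
    (if i \<in> T then 0 else pmf \<mu> (insert i T) / measure_pmf.prob \<mu> {S. i \<in> S})"
proof -
  let ?C = "cond_pmf \<mu> {S. i \<in> S}"
  have ne: "set_pmf \<mu> \<inter> {S. i \<in> S} \<noteq> {}"
    using assms measure_pmf_zero_iff[of \<mu> "{S. i \<in> S}"] by auto
  have "pmf (cond_in \<mu> i) T = measure_pmf.prob ?C ((\<lambda>S. S - {i}) -` {T})"
    by (simp add: cond_in_def pmf_map)
  also have "\<dots> = measure_pmf.prob ?C (if i \<in> T then {} else {insert i T})"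
    by (rule measure_pmf.finite_measure_eq_AE) (auto simp: AE_measure_pmf_iff set_cond_pmf[OF ne])
  finally show ?thesis
    by (simp add: measure_pmf_single pmf_cond[OF ne])
qed

lemma pmf_cond_notin:
  assumes "measure_pmf.prob \<mu> {S. i \<in> S} < 1"
  shows "pmf (cond_notin \<mu> i) T =
    (if i \<in> T then 0 else pmf \<mu> T / measure_pmf.prob \<mu> {S. i \<notin> S})"
proof -
  let ?C = "cond_pmf \<mu> {S. i \<notin> S}"
  \<comment> \<open>A probability below \<open>1\<close> leaves a support point that avoids
    \<open>i\<close>, as \<open>cond_pmf\<close> requires.\<close>
  have ne: "set_pmf \<mu> \<inter> {S. i \<notin> S} \<noteq> {}"
    using assms measure_pmf.prob_eq_1[of "{S. i \<in> S}" \<mu>] by (auto simp: AE_measure_pmf_iff)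
  have "pmf (cond_notin \<mu> i) T = measure_pmf.prob ?C ((\<lambda>S. S - {i}) -` {T})"
    by (simp add: cond_notin_def pmf_map)
  also have "\<dots> = measure_pmf.prob ?C (if i \<in> T then {} else {T})"
    by (rule measure_pmf.finite_measure_eq_AE) (auto simp: AE_measure_pmf_iff set_cond_pmf[OF ne])
  finally show ?thesis
    by (simp add: measure_pmf_single pmf_cond[OF ne])
qed

text \<open>The penalised parity is toggled at \<open>b\<close> and then at \<open>a\<close>,
  passing through the law for \<open>{a}\<close>. No vertex is revealed at the start, so each toggle
  costs \<open>s * (1 + s)\<close>.\<close>

lemma transport_edge_discrepancy:
  fixes h :: real
  assumes graph: "finite_simple_graph V F" and p: "\<forall>e\<in>F. 0 \<le> p e \<and> p e < 1"
    and eta: "\<forall>v\<in>V. h \<le> \<eta> v \<and> \<eta> v \<le> 1" and h: "0 < h" "h \<le> 1"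
    and ab: "a \<in> V" "b \<in> V" "a \<noteq> b"
  shows "transport F (parity_weight V p F \<eta> {a, b}) (parity_weight V p F \<eta> {}) (1 / (2 * h\<^sup>2))"
proof -
  define s where "s = (1 - h) / (2 * h)"
  have finF: "finite F"
    using graph by (rule finite_simple_graph_finite_edges)
  have nonneg: "0 \<le> parity_weight V p F \<eta> B S" if "S \<subseteq> F" for B S
    using p eta h that by (intro parity_weight_nonneg) force+
  have D: "{v \<in> V. \<eta> v = 0} = {}"
    using eta h by force
  \<comment> \<open>Edges have two elements, so the empty set is not an edge.\<close>
  have within_empty: "{e \<in> F. e \<subseteq> {}} = {}"
    using graph by (auto simp: finite_simple_graph_def)
  then have single: "transport F (parity_weight V p F \<eta> B) (parity_weight V p F \<eta> (sym_diff B {u})) (s * (1 + s))"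
    if "u \<in> V" for u B
  proof -
    have "\<forall>e\<in>F. 0 \<le> p e \<and> p e \<le> 1" "\<forall>v\<in>V. \<eta> v = 0 \<or> h \<le> \<eta> v \<and> \<eta> v \<le> 1" "\<eta> u \<noteq> 0"
      using p eta h that by force+
    then show ?thesis
      using transport_single_discrepancy[OF graph _ _ that h s_def, of p \<eta> B, unfolded D within_empty]
      by simp
  qed
  \<comment> \<open>The empty edge set witnesses positive mass of the intermediate law, because
    \<open>p e < 1\<close> and \<open>\<eta>\<close> is positive.\<close>
  have "0 < parity_weight V p F \<eta> {a} {}"
    unfolding parity_weight_def using p eta h
    by (intro mult_pos_pos prod_pos) force+
  also have "\<dots> \<le> sum (parity_weight V p F \<eta> {a}) (Pow F)"
    using finF nonneg by (intro member_le_sum) auto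
  finally have pos: "0 < sum (parity_weight V p F \<eta> {a}) (Pow F)" .
  have "sym_diff {a, b} {b} = {a}" "sym_diff {a} {a} = {}"
    using ab by auto
  then have "transport F (parity_weight V p F \<eta> {a, b}) (parity_weight V p F \<eta> {})
      (s * (1 + s) + s * (1 + s))"
    using single[OF ab(2), of "{a, b}"] single[OF ab(1), of "{a}"]
    by (intro transport_trans[OF finF _ _ nonneg pos]) auto
  moreover have "s * (1 + s) + s * (1 + s) \<le> 1 / (2 * h\<^sup>2)"
  proof -
    have "s * (1 + s) + s * (1 + s) = 1 / (2 * h\<^sup>2) - 1 / 2"
      using h by (simp add: s_def field_simps power2_eq_square)
    then show ?thesis by simp
  qed
  ultimately show ?thesis
    by (rule transport_mono) (use nonneg in auto)
qed

theorem lemma4p4: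
  fixes V :: "'v set" and E :: "'v set set"
    and p :: "'v set \<Rightarrow> real" and \<eta> :: "'v \<Rightarrow> real"
  assumes "finite_simple_graph V E"
    and "\<forall>e\<in>E. 0 \<le> p e \<and> p e \<le> 1 / 2"
    and "\<forall>v\<in>V. 0 < \<eta> v \<and> \<eta> v \<le> 1"
  shows "coupling_independent E (subgraph_world V E p \<eta>) (1 / (2 * (Min (\<eta> ` V))\<^sup>2))"
proof -
  let ?\<nu> = "subgraph_world V E p \<eta>"
  define Z where "Z = (\<Sum>T\<in>Pow E. sw_weight V E p \<eta> T)"
  have finV: "finite V"
    using assms(1) by (simp add: finite_simple_graph_def)
  have finE: "finite E"
    using assms(1) by (rule finite_simple_graph_finite_edges)
  have p: "0 \<le> p e" "p e < 1" if "e \<in> E" for e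
    using assms(2) that by force+
  have \<nu>: "pmf ?\<nu> S = (if S \<subseteq> E then parity_weight V p E \<eta> {} S / Z else 0)" for S
    using pmf_subgraph_world[OF assms(1), of p \<eta> S] p assms(3)
    by (auto simp: Z_def sw_weight_eq_parity_weight[OF finV])
  have "0 \<le> Z"
    unfolding Z_def using p assms(3)
    by (intro sum_nonneg)
      (auto simp: sw_weight_eq_parity_weight[OF finV] less_imp_le intro!: parity_weight_nonneg)
  show ?thesis
    unfolding coupling_independent_def
  proof (intro conjI ballI impI)
    show "finite E" by (rule finE)
    show "set_pmf ?\<nu> \<subseteq> Pow E"
      by (auto simp: set_pmf_iff \<nu> split: if_splits)
  next
    fix i assume i: "i \<in> E"
      and prob: "0 < measure_pmf.prob ?\<nu> {S. i \<in> S} \<and> measure_pmf.prob ?\<nu> {S. i \<in> S} < 1"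
    obtain a b where ab: "i = {a, b}" "a \<noteq> b" "a \<in> V" "b \<in> V"
      using assms(1) i unfolding finite_simple_graph_def card_2_iff by force
    define F where "F = E - {i}"
    have F: "E = insert i F" "i \<notin> F" "finite F"
      using i finE by (auto simp: F_def)
    let ?h = "Min (\<eta> ` V)"
    \<comment> \<open>The edge \<open>i\<close> makes \<open>V\<close> nonempty, so
      \<open>Min\<close> is a genuine minimum here.\<close>
    have "?h \<in> \<eta> ` V"
      using finV ab(3) by (intro Min_in) auto
    then have h: "0 < ?h" "?h \<le> 1"
      using assms(3) by auto
    have sub: "T \<subseteq> E \<longleftrightarrow> T \<subseteq> F" if "i \<notin> T" for T
      using that F by auto
    show "\<exists>\<pi>. is_coupling \<pi> (cond_in ?\<nu> i) (cond_notin ?\<nu> i) \<and>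
        measure_pmf.expectation \<pi> (\<lambda>(X, Y). real (card (sym_diff X Y))) \<le> 1 / (2 * ?h\<^sup>2)"
    proof (rule coupling_of_transport[OF F(3)])
      \<comment> \<open>Requiring \<open>i\<close> toggles the penalised parity at its endpoints, so
        \<open>i\<close> itself, as a vertex set, plays the part of \<open>B\<close> in the first
        weight.\<close>
      show "transport F (parity_weight V p F \<eta> i) (parity_weight V p F \<eta> {}) (1 / (2 * ?h\<^sup>2))"
        unfolding ab(1)
      proof (rule transport_edge_discrepancy)
        show "finite_simple_graph V F"
          using assms(1) by (rule finite_simple_graph_subset) (auto simp: F_def)
      qed (use p assms(3) finV h ab in \<open>auto simp: F_def\<close>)
      let ?q = "measure_pmf.prob ?\<nu> {S. i \<in> S}" and ?r = "measure_pmf.prob ?\<nu> {S. i \<notin> S}"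
      \<comment> \<open>The constant collects the edge factor \<open>p i\<close>, the partition
        function \<open>Z\<close> and the probability of the conditioning event.\<close>
      show "pmf (cond_in ?\<nu> i) T = (if T \<subseteq> F then p i / (Z * ?q) * parity_weight V p F \<eta> i T else 0)" for T
      proof (cases "i \<in> T")
        case False
        then show ?thesis
          using parity_weight_insert_edge_in[OF F(3,2), of T V p \<eta> "{}"] sub[OF False] i
          by (simp add: pmf_cond_in[OF conjunct1[OF prob]] \<nu> flip: F(1))
      next
        case True
        then have "\<not> T \<subseteq> F"
          using F(2) by auto
        with True show ?thesis
          by (simp add: pmf_cond_in[OF conjunct1[OF prob]])
      qed
      show "pmf (cond_notin ?\<nu> i) T = (if T \<subseteq> F then (1 - p i) / (Z * ?r) * parity_weight V p F \<eta> {} T else 0)" for T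
      proof (cases "i \<in> T")
        case False
        then show ?thesis
          using parity_weight_insert_edge_notin[OF F(3,2), of T V p \<eta> "{}"] sub[OF False]
          by (simp add: pmf_cond_notin[OF conjunct2[OF prob]] \<nu> flip: F(1))
      next
        case True
        then have "\<not> T \<subseteq> F"
          using F(2) by auto
        with True show ?thesis
          by (simp add: pmf_cond_notin[OF conjunct2[OF prob]])
      qed
      show "0 \<le> p i / (Z * ?q)" "0 \<le> (1 - p i) / (Z * ?r)"
        using p[OF i] \<open>0 \<le> Z\<close> by auto
    qed
  qed
qed

end
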